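(* Consider the game ${\rm SCN}(5,2)$. Its P-positions (among all configurations that can arise, i.e. circular arrangements of at most $5$ piles with positive pile sizes) are exactly the following: (1) the terminal configuration $()$; (2) $(a,a,a)$ with $a\ge 1$; (3) $(a,b,a,b)$ with $a,b\ge1$, $a\neq b$; (4) $(M,m,a,b,m)$ with $m\ge 1$, $m<a<M$, $m<b<M$ and $m+M=a+b$; (5) $(m+1,M,m,m,M)$ with $m\ge 1$ even and $M\ge m+2$; (6) $(m+1,M,m,m,M)$ with $m\ge 1$ odd and $M\ge m+3$; (7) $(m+2,m+1,m,m,m+1)$ with $m\ge 1$ odd; (8) $(m+1,m+1,m,m,m+2)$ with $m\ge 1$ odd.
   Context: Shrinking Circular Nim ${\rm SCN}(n,k)$, for positive integers $k\le n$: initially $n$ piles of stones are arranged on a circle. Two players alternate turns. On a turn, a player selects $k$ consecutive (cyclically adjacent) piles among the currently remaining piles and removes any number of stones from each of them, removing at least one stone in total (some of the selected piles may be left untouched). Whenever a pile becomes empty it vanishes and the circle closes up: the remaining piles keep their cyclic order and the neighbours of the vanished pile become adjacent. If at most $k$ piles remain, a move may remove stones from any of the remaining piles (all of them may be selected). The player who removes the last stone wins (a player with no move loses). A configuration is written as the tuple $(x_1,\dots,x_r)$ of the positive pile sizes in cyclic order; tuples that agree up to rotation or reflection denote the same configuration, and $()$ denotes the empty (terminal) configuration. A P-position is a configuration from which the player to move loses under optimal play by the opponent. *)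

theory Defs
  imports Main
begin

text \<open>
  A configuration is represented by any list of its pile sizes in cyclic order, so several lists
  denote one configuration; \<open>same_configuration\<close> is the corresponding equivalence.
\<close>

definition scn_configuration :: "nat \<Rightarrow> nat list \<Rightarrow> bool" where
  "scn_configuration n xs \<longleftrightarrow> length xs \<le> n \<and> (\<forall>x\<in>set xs. 0 < x)"

definition same_configuration :: "nat list \<Rightarrow> nat list \<Rightarrow> bool" where
  "same_configuration xs ys \<longleftrightarrow> (\<exists>i. ys = rotate i xs \<or> ys = rotate i (rev xs))"

definition cyclic_window :: "nat \<Rightarrow> nat \<Rightarrow> nat \<Rightarrow> nat set" where
  "cyclic_window k r i = {(i + t) mod r | t. t < k}"

text \<open>
  Here \<open>zs\<close> holds the pile sizes before the emptied piles vanish. If at most \<open>k\<close> piles remain,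
  every cyclic window of width \<open>k\<close> contains all of them.
\<close>

definition scn_move :: "nat \<Rightarrow> nat list \<Rightarrow> nat list \<Rightarrow> bool" where
  "scn_move k xs ys \<longleftrightarrow>
     (\<exists>i<length xs. \<exists>zs. length zs = length xs \<and> zs \<noteq> xs \<and>
        (\<forall>j<length xs. zs ! j \<le> xs ! j) \<and>
        (\<forall>j<length xs. j \<notin> cyclic_window k (length xs) i \<longrightarrow> zs ! j = xs ! j) \<and>
        ys = filter (\<lambda>x. 0 < x) zs)"

text \<open>
  Outcomes under normal play: \<open>previous_wins move x\<close> (\<open>next_wins move x\<close>) says that the player to
  move at \<open>x\<close> loses (wins) under optimal play. A position without moves falls under
  \<open>previous_winsI\<close>.
\<close>

inductive previous_wins :: "('a \<Rightarrow> 'a \<Rightarrow> bool) \<Rightarrow> 'a \<Rightarrow> bool"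
  and next_wins :: "('a \<Rightarrow> 'a \<Rightarrow> bool) \<Rightarrow> 'a \<Rightarrow> bool"
  for move :: "'a \<Rightarrow> 'a \<Rightarrow> bool" where
  previous_winsI: "(\<And>y. move x y \<Longrightarrow> next_wins move y) \<Longrightarrow> previous_wins move x"
| next_winsI: "move x y \<Longrightarrow> previous_wins move y \<Longrightarrow> next_wins move x"

definition scn_P_position :: "nat \<Rightarrow> nat \<Rightarrow> nat list \<Rightarrow> bool" where
  "scn_P_position n k xs \<longleftrightarrow> scn_configuration n xs \<and> previous_wins (scn_move k) xs"

end

theory Submission
  imports Defs
begin

text \<open>
  The P-positions are the unique set that no move connects to itself and that every position outside
  can enter. Both properties are invariant under rotation and reflection, so a move can be placed on
  the first two piles.

  A five-pile position wins by removing one pile whenever two non-adjacent piles \<open>c\<close> are equal and the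
  pile \<open>d\<close> between them is equal to \<open>c\<close> or at most one of the other two: the move leads to
  \<open>(c, c, c)\<close> or \<open>(d, c, d, c)\<close>. Apart from this, the winning moves depend on where the minimum \<open>m\<close>
  occurs. If it occurs once, or at two non-adjacent places, one can restore \<open>(M, m, a, b, m)\<close> with
  \<open>m + M = a + b\<close>. If it occurs exactly at two adjacent places, \<open>(p, M, m, m, N)\<close>, one adjusts \<open>p\<close> and \<open>N\<close>;
  for even \<open>m\<close> and \<open>M = m + 1\<close> both drop to \<open>m - 1\<close>, and this is where the parity enters.
\<close>

section \<open>Listed configurations\<close>

text \<open>The disjunction keeps the exact shape of the right-hand side of the final theorem, so
  that unfolding alone yields the goal there.\<close>

definition normal_form :: "nat list \<Rightarrow> bool" where
  "normal_form ys \<longleftrightarrow>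
      ys = [] \<or>
       (\<exists>a. a \<ge> 1 \<and> ys = [a, a, a]) \<or>
       (\<exists>a b. a \<ge> 1 \<and> b \<ge> 1 \<and> a \<noteq> b \<and> ys = [a, b, a, b]) \<or>
       (\<exists>m M a b. m \<ge> 1 \<and> m < a \<and> a < M \<and> m < b \<and> b < M \<and> m + M = a + b \<and>
          ys = [M, m, a, b, m]) \<or>
       (\<exists>m M. m \<ge> 1 \<and> even m \<and> M \<ge> m + 2 \<and> ys = [m + 1, M, m, m, M]) \<or>
       (\<exists>m M. m \<ge> 1 \<and> odd m \<and> M \<ge> m + 3 \<and> ys = [m + 1, M, m, m, M]) \<or>
       (\<exists>m. m \<ge> 1 \<and> odd m \<and> ys = [m + 2, m + 1, m, m, m + 1]) \<or>
       (\<exists>m. m \<ge> 1 \<and> odd m \<and> ys = [m + 1, m + 1, m, m, m + 2])"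

definition listed :: "nat list \<Rightarrow> bool" where
  "listed xs \<longleftrightarrow> (\<exists>ys. same_configuration xs ys \<and> normal_form ys)"

definition winnable :: "nat list \<Rightarrow> bool" where
  "winnable xs \<longleftrightarrow> (\<exists>ys. scn_move 2 xs ys \<and> listed ys)"

section \<open>Equivalence of configurations under rotation and reflection\<close>

lemma ex_rotate_conv:
  assumes "xs \<noteq> []"
  shows "(\<exists>i. ys = rotate i xs) \<longleftrightarrow> (\<exists>i<length xs. ys = rotate i xs)"
  using assms by (metis length_greater_0_conv mod_less_divisor rotate_conv_mod)

text \<open>The bound on the index lets the representatives of a list of known length be enumerated
  by simplification.\<close>

lemma same_configuration_conv:
  assumes "xs \<noteq> []"
  shows "same_configuration xs ys \<longleftrightarrow>
    (\<exists>i<length xs. ys = rotate i xs \<or> ys = rotate i (rev xs))"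
  using ex_rotate_conv[OF assms, of ys] ex_rotate_conv[of "rev xs" ys] assms
  unfolding same_configuration_def by fastforce

lemma same_configuration_refl: "same_configuration xs xs"
  unfolding same_configuration_def by (metis rotate0 id_apply)

lemma rotate_inverse: "\<exists>j. rotate j (rotate i xs) = xs"
proof (cases "xs = []")
  case False
  \<comment> \<open>Each of the \<open>i\<close> rotation steps is completed by
    \<open>length xs - 1\<close> further ones to a full turn.\<close>
  then have "i * (length xs - 1) + i = i * length xs"
    by (cases xs) auto
  then have "rotate (i * (length xs - 1)) (rotate i xs) = xs"
    by (simp add: rotate_rotate rotate_id)
  then show ?thesis by blast
qed simp

lemma rev_rotate_ex: "\<exists>j. rev (rotate i xs) = rotate j (rev xs)"
  by (metis rotate_rev rev_rev_ident rotate_inverse)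

lemma same_configuration_sym:
  assumes "same_configuration xs ys" shows "same_configuration ys xs"
  using assms unfolding same_configuration_def
  by (metis rev_rev_ident rev_rotate_ex rotate_inverse)

lemma same_configuration_rotate: "same_configuration xs (rotate i xs)"
  unfolding same_configuration_def by blast

lemma same_configuration_rev: "same_configuration xs (rev xs)"
  unfolding same_configuration_def by (metis rotate0 id_apply)

lemma same_configuration_trans:
  assumes "same_configuration xs ys" "same_configuration ys zs"
  shows "same_configuration xs zs"
proof -
  obtain us where us: "us = xs \<or> us = rev xs" and "\<exists>i. ys = rotate i us"
    using assms(1) unfolding same_configuration_def by blast
  then obtain i where ys: "ys = rotate i us" by blast
  obtain l where "rev ys = rotate l (rev us)"
    using rev_rotate_ex ys by blast
  with ys obtain k where "zs = rotate k us \<or> zs = rotate k (rev us)"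
    using assms(2) unfolding same_configuration_def by (auto simp: rotate_rotate)
  with us show ?thesis
    unfolding same_configuration_def by auto
qed

lemma listed_cong:
  assumes "same_configuration xs ys" shows "listed xs \<longleftrightarrow> listed ys"
  using same_configuration_trans[OF assms] same_configuration_trans[OF same_configuration_sym[OF assms]]
  unfolding listed_def by blast

text \<open>Rotation swaps an initial segment with the rest. After filtering, the segment has fewer
  entries, so the rotation index becomes the number of its surviving entries.\<close>

lemma filter_rotate_ex: "\<exists>j. filter P (rotate i xs) = rotate j (filter P xs)"
proof -
  let ?n = "i mod length xs"
  have "filter P (rotate i xs) = filter P (drop ?n xs) @ filter P (take ?n xs)"
    by (simp add: rotate_drop_take)
  also have "\<dots> = rotate (length (filter P (take ?n xs))) (filter P (take ?n xs) @ filter P (drop ?n xs))"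
    by (simp only: rotate_append)
  also have "filter P (take ?n xs) @ filter P (drop ?n xs) = filter P xs"
    by (metis append_take_drop_id filter_append)
  finally show ?thesis by blast
qed

lemma listed_filter_rotate: "listed (filter P (rotate i xs)) \<longleftrightarrow> listed (filter P xs)"
  using filter_rotate_ex[of P i xs] listed_cong same_configuration_rotate by metis

text \<open>
  The two possible positions of the repeated minimum: \<open>far\<close> is family (4), and \<open>near\<close> collects
  families (5)--(8), with both reflections of (8).
\<close>

definition far :: "nat \<Rightarrow> nat \<Rightarrow> nat \<Rightarrow> nat \<Rightarrow> nat \<Rightarrow> bool" where
  "far M m a b n \<longleftrightarrow> n = m \<and> m < a \<and> a < M \<and> m < b \<and> b < M \<and> m + M = a + b"

definition near :: "nat \<Rightarrow> nat \<Rightarrow> nat \<Rightarrow> nat \<Rightarrow> nat \<Rightarrow> bool" where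
  "near p M m n N \<longleftrightarrow> n = m \<and>
     (p = m + 1 \<and> N = M \<and> m + 2 \<le> M \<and> (even m \<or> m + 3 \<le> M) \<or>
      odd m \<and> (p = m + 2 \<and> M = m + 1 \<and> N = m + 1 \<or>
               p = m + 1 \<and> (M = m + 1 \<and> N = m + 2 \<or> M = m + 2 \<and> N = m + 1)))"

definition five_piles :: "nat \<Rightarrow> nat \<Rightarrow> nat \<Rightarrow> nat \<Rightarrow> nat \<Rightarrow> bool" where
  "five_piles a b c d e \<longleftrightarrow> far a b c d e \<or> near a b c d e"

abbreviation five_piles_rotated :: "nat \<Rightarrow> nat \<Rightarrow> nat \<Rightarrow> nat \<Rightarrow> nat \<Rightarrow> bool" where
  "five_piles_rotated a b c d e \<equiv> five_piles a b c d e \<or> five_piles b c d e a \<or>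
     five_piles c d e a b \<or> five_piles d e a b c \<or> five_piles e a b c d"

section \<open>Listed tuples of each length as conditions on the pile sizes\<close>

lemma normal_form_5:
  assumes "0 < a" "0 < b" "0 < c" "0 < d" "0 < e"
  shows "normal_form [a, b, c, d, e] \<or> normal_form [a, e, d, c, b] \<longleftrightarrow> five_piles a b c d e"
proof -
  have *: "normal_form [p, q, r, s, t] \<longleftrightarrow> far p q r s t \<or> s = r \<and>
      (p = r + 1 \<and> t = q \<and> r + 2 \<le> q \<and> (even r \<or> r + 3 \<le> q) \<or>
      odd r \<and> p = r + 2 \<and> q = r + 1 \<and> t = r + 1 \<or>
      odd r \<and> p = r + 1 \<and> q = r + 1 \<and> t = r + 2)"
    if "0 < q" "0 < r" for p q r s t
    unfolding normal_form_def far_def using that by simp auto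
  \<comment> \<open>Reflection fixing the first pile merely exchanges the two middle piles of
    \<open>far\<close>. The mirror image of the last family is the only new case, and
    \<open>near\<close> includes it.\<close>
  have "far a e d c b \<longleftrightarrow> far a b c d e"
    unfolding far_def by (auto simp: add.commute)
  then show ?thesis
    unfolding *[OF assms(2,3)] *[OF assms(5,4)] five_piles_def near_def by fastforce
qed

text \<open>The ten representatives of a circle of five piles form five mirror pairs, one for each
  starting pile; each pair collapses to a single \<open>five_piles\<close> condition.\<close>

lemma listed_5:
  assumes "0 < a" "0 < b" "0 < c" "0 < d" "0 < e"
  shows "listed [a, b, c, d, e] \<longleftrightarrow> five_piles_rotated a b c d e"
proof -
  have "listed [a, b, c, d, e] \<longleftrightarrow>
     (normal_form [a, b, c, d, e] \<or> normal_form [a, e, d, c, b]) \<or>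
     (normal_form [b, c, d, e, a] \<or> normal_form [b, a, e, d, c]) \<or>
     (normal_form [c, d, e, a, b] \<or> normal_form [c, b, a, e, d]) \<or>
     (normal_form [d, e, a, b, c] \<or> normal_form [d, c, b, a, e]) \<or>
     (normal_form [e, a, b, c, d] \<or> normal_form [e, d, c, b, a])"
  proof -
    have "same_configuration [a, b, c, d, e] ys \<longleftrightarrow>
      ys \<in> {[a, b, c, d, e], [a, e, d, c, b], [b, c, d, e, a], [b, a, e, d, c], [c, d, e, a, b],
        [c, b, a, e, d], [d, e, a, b, c], [d, c, b, a, e], [e, a, b, c, d], [e, d, c, b, a]}" for ys
      by (auto simp: same_configuration_conv Ex_less_Suc)
    then show ?thesis unfolding listed_def by (simp add: conj_disj_distribR ex_disj_distrib)
  qed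
  then show ?thesis using assms by (simp add: normal_form_5)
qed

lemma listed_4:
  assumes "0 < a" "0 < b" "0 < c" "0 < d"
  shows "listed [a, b, c, d] \<longleftrightarrow> a = c \<and> b = d \<and> a \<noteq> b"
proof -
  have "same_configuration [a, b, c, d] ys \<longleftrightarrow>
      ys \<in> {[a, b, c, d], [a, d, c, b], [b, c, d, a], [b, a, d, c], [c, d, a, b], [c, b, a, d],
        [d, a, b, c], [d, c, b, a]}" for ys
    by (auto simp: same_configuration_conv Ex_less_Suc)
  moreover have "normal_form [p, q, r, s] \<longleftrightarrow> 0 < p \<and> 0 < q \<and> p = r \<and> q = s \<and> p \<noteq> q" for p q r s
    unfolding normal_form_def by auto
  ultimately show ?thesis
    using assms by (auto simp: listed_def conj_disj_distribR ex_disj_distrib)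
qed

lemma listed_3:
  assumes "0 < a" "0 < b" "0 < c"
  shows "listed [a, b, c] \<longleftrightarrow> a = b \<and> b = c"
proof -
  have "same_configuration [a, b, c] ys \<longleftrightarrow>
      ys \<in> {[a, b, c], [a, c, b], [b, c, a], [b, a, c], [c, a, b], [c, b, a]}" for ys
    by (auto simp: same_configuration_conv Ex_less_Suc)
  moreover have "normal_form [p, q, r] \<longleftrightarrow> 0 < p \<and> p = q \<and> q = r" for p q r
    unfolding normal_form_def by auto
  ultimately show ?thesis
    using assms by (auto simp: listed_def conj_disj_distribR ex_disj_distrib)
qed

lemma same_configuration_length: "same_configuration xs ys \<Longrightarrow> length ys = length xs"
  unfolding same_configuration_def by auto

lemma not_listed:
  assumes "length xs = 1 \<or> length xs = 2"
  shows "\<not> listed xs"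
  using assms unfolding listed_def normal_form_def
  by (auto dest!: same_configuration_length)

lemma listed_Nil: "listed []"
  unfolding listed_def normal_form_def by (metis same_configuration_refl)

section \<open>Moves in a window\<close>

text \<open>A move in the window of the first two piles; \<open>vs\<close> still contains the emptied piles.\<close>

definition window_win :: "nat list \<Rightarrow> bool" where
  "window_win us \<longleftrightarrow> (\<exists>vs. length vs = length us \<and> vs \<noteq> us \<and> (\<forall>j<length us. vs ! j \<le> us ! j) \<and>
     drop 2 vs = drop 2 us \<and> listed (filter (\<lambda>x. 0 < x) vs))"

section \<open>Moving an arbitrary window to the front by rotation\<close>

lemma all_less_rotate:
  fixes i n :: nat
  assumes "i < n"
  shows "(\<forall>j<n. P j) \<longleftrightarrow> (\<forall>j<n. P ((i + j) mod n))"
proof (intro iffI allI impI)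
  fix j assume all: "\<forall>j<n. P ((i + j) mod n)" and "j < n"
  \<comment> \<open>The shift by \<open>i\<close> modulo \<open>n\<close> is onto: this gives the
    preimage of \<open>j\<close>.\<close>
  have "(i + (n - i + j) mod n) mod n = j"
    using assms \<open>j < n\<close> by (simp add: mod_add_right_eq)
  then show "P j"
    using all assms by (metis mod_less_divisor gr_implies_not0 neq0_conv)
next
  fix j assume all: "\<forall>j<n. P j" and "j < n"
  then show "P ((i + j) mod n)" by simp
qed

lemma in_cyclic_window_rotate:
  assumes "i < n" "j < n"
  shows "(i + j) mod n \<in> cyclic_window 2 n i \<longleftrightarrow> j < 2"
proof -
  \<comment> \<open>Adding \<open>n - i\<close> undoes the shift by \<open>i\<close>, so shifted
    indices agree modulo \<open>n\<close> only if the original ones do.\<close>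
  have cancel: "(n - i + (i + t) mod n) mod n = t mod n" for t
    using assms(1) by (subst mod_add_right_eq) simp
  have "(i + j) mod n = (i + t) mod n \<longleftrightarrow> j mod n = t mod n" for t
    by (metis cancel mod_add_right_eq)
  then have "(i + j) mod n \<in> cyclic_window 2 n i \<longleftrightarrow> (\<exists>t<2. j = t mod n)"
    using assms(2) unfolding cyclic_window_def by auto
  also have "\<dots> \<longleftrightarrow> j < 2"
    using assms(2) by (metis le_less_trans mod_less mod_less_eq_dividend)
  finally show ?thesis .
qed

lemma bij_rotate: "bij (rotate n)"
  unfolding rotate_def by (intro bij_fn bij_rotate1)

lemma ex_rotate: "(\<exists>zs. Q (rotate i zs)) \<longleftrightarrow> (\<exists>vs. Q vs)"
  by (metis bij_rotate bij_pointE)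

lemma drop_2_eq_conv:
  assumes "length vs = length us"
  shows "drop 2 vs = drop 2 us \<longleftrightarrow> (\<forall>j<length us. \<not> j < 2 \<longrightarrow> vs ! j = us ! j)"
proof
  assume "drop 2 vs = drop 2 us"
  then show "\<forall>j<length us. \<not> j < 2 \<longrightarrow> vs ! j = us ! j"
  proof (intro allI impI)
    fix j assume "j < length us" "\<not> j < 2"
    then obtain k where "j = 2 + k"
      by (metis le_Suc_ex not_less)
    with \<open>j < length us\<close> assms have "vs ! j = drop 2 vs ! k" "us ! j = drop 2 us ! k"
      by (simp_all add: nth_drop)
    with \<open>drop 2 vs = drop 2 us\<close> show "vs ! j = us ! j"
      by simp
  qed
next
  assume "\<forall>j<length us. \<not> j < 2 \<longrightarrow> vs ! j = us ! j"
  then show "drop 2 vs = drop 2 us"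
    using assms by (intro nth_equalityI) auto
qed

text \<open>The rotation acts on \<open>zs\<close>, which still contains the emptied piles, so
  indices of \<open>zs\<close> and \<open>xs\<close> stay aligned. Every conjunct transfers along
  it, and bijectivity of the rotation then matches the witnesses.\<close>

lemma window_win_rotate:
  assumes "i < length xs"
  shows "window_win (rotate i xs) \<longleftrightarrow>
    (\<exists>zs. length zs = length xs \<and> zs \<noteq> xs \<and> (\<forall>j<length xs. zs ! j \<le> xs ! j) \<and>
      (\<forall>j<length xs. j \<notin> cyclic_window 2 (length xs) i \<longrightarrow> zs ! j = xs ! j) \<and>
      listed (filter (\<lambda>x. 0 < x) zs))" (is "_ \<longleftrightarrow> (\<exists>zs. ?A zs)")
proof -
  let ?W = "\<lambda>vs. length vs = length (rotate i xs) \<and> vs \<noteq> rotate i xs \<and>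
    (\<forall>j<length (rotate i xs). vs ! j \<le> rotate i xs ! j) \<and>
    drop 2 vs = drop 2 (rotate i xs) \<and> listed (filter (\<lambda>x. 0 < x) vs)"
  have *: "?A zs \<longleftrightarrow> ?W (rotate i zs)" for zs
  proof (cases "length zs = length xs")
    case True
    have "rotate i zs = rotate i xs \<longleftrightarrow> zs = xs"
      using bij_rotate by (metis bij_def injD)
    moreover have "(\<forall>j<length xs. zs ! j \<le> xs ! j) \<longleftrightarrow>
        (\<forall>j<length xs. rotate i zs ! j \<le> rotate i xs ! j)"
      using True by (subst all_less_rotate[OF assms]) (simp add: nth_rotate)
    moreover have "(\<forall>j<length xs. j \<notin> cyclic_window 2 (length xs) i \<longrightarrow> zs ! j = xs ! j) \<longleftrightarrow>
        drop 2 (rotate i zs) = drop 2 (rotate i xs)"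
      using True assms
      by (subst all_less_rotate[OF assms])
        (auto simp: nth_rotate in_cyclic_window_rotate drop_2_eq_conv)
    ultimately show ?thesis
      using True by (simp add: listed_filter_rotate)
  qed simp
  show ?thesis
    unfolding window_win_def * by (rule ex_rotate[of ?W, symmetric])
qed

lemma winnable_conv: "winnable xs \<longleftrightarrow> (\<exists>i<length xs. window_win (rotate i xs))"
proof -
  have "winnable xs \<longleftrightarrow> (\<exists>i<length xs.
    (\<exists>zs. length zs = length xs \<and> zs \<noteq> xs \<and> (\<forall>j<length xs. zs ! j \<le> xs ! j) \<and>
      (\<forall>j<length xs. j \<notin> cyclic_window 2 (length xs) i \<longrightarrow> zs ! j = xs ! j) \<and>
      listed (filter (\<lambda>x. 0 < x) zs)))"
    unfolding winnable_def scn_move_def by blast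
  also have "\<dots> \<longleftrightarrow> (\<exists>i<length xs. window_win (rotate i xs))"
    by (simp add: window_win_rotate cong: conj_cong)
  finally show ?thesis .
qed

lemma window_win_Cons_Cons:
  "window_win (p # q # rs) \<longleftrightarrow>
    (\<exists>p'\<le>p. \<exists>q'\<le>q. (p' \<noteq> p \<or> q' \<noteq> q) \<and> listed (filter (\<lambda>x. 0 < x) (p' # q' # rs)))"
proof
  have *: "drop 2 (p # q # rs) = rs"
    by simp
  assume "window_win (p # q # rs)"
  then obtain vs where vs: "length vs = length (p # q # rs)" "vs \<noteq> p # q # rs"
    "\<forall>j<length (p # q # rs). vs ! j \<le> (p # q # rs) ! j" "drop 2 vs = rs"
    "listed (filter (\<lambda>x. 0 < x) vs)"
    unfolding window_win_def * by blast
  obtain p' q' rs' where "vs = p' # q' # rs'"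
    using vs(1) by (auto simp: length_Suc_conv)
  with vs(4) have v: "vs = p' # q' # rs"
    by simp
  have "p' \<le> p" "q' \<le> q"
    using vs(3)[rule_format, of 0] vs(3)[rule_format, of 1] by (simp_all add: v)
  moreover have "p' \<noteq> p \<or> q' \<noteq> q"
    using vs(2) by (auto simp: v)
  ultimately show "\<exists>p'\<le>p. \<exists>q'\<le>q. (p' \<noteq> p \<or> q' \<noteq> q) \<and> listed (filter (\<lambda>x. 0 < x) (p' # q' # rs))"
    using vs(5) unfolding v by blast
next
  assume "\<exists>p'\<le>p. \<exists>q'\<le>q. (p' \<noteq> p \<or> q' \<noteq> q) \<and> listed (filter (\<lambda>x. 0 < x) (p' # q' # rs))"
  then obtain p' q' where "p' \<le> p" "q' \<le> q" "p' \<noteq> p \<or> q' \<noteq> q"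
    "listed (filter (\<lambda>x. 0 < x) (p' # q' # rs))"
    by blast
  then show "window_win (p # q # rs)"
    unfolding window_win_def
    by (intro exI[of _ "p' # q' # rs"]) (simp add: nth_Cons split: nat.split)
qed

lemma window_winI:
  assumes "listed (filter (\<lambda>x. 0 < x) (p' # q' # rs))" "p' \<le> p" "q' \<le> q" "p' \<noteq> p \<or> q' \<noteq> q"
  shows "window_win (p # q # rs)"
  using assms unfolding window_win_Cons_Cons by blast

text \<open>The three disjuncts correspond to two, one or no emptied piles. A single survivor
  \<open>x\<close> takes the same place in the circle whichever pile it comes from, so it only has
  to fit below one of them.\<close>

lemma window_win_pos:
  assumes "0 < p" "0 < q" "\<forall>x\<in>set rs. 0 < x"
  shows "window_win (p # q # rs) \<longleftrightarrow>
    listed rs \<or> (\<exists>x. 0 < x \<and> (x \<le> p \<or> x \<le> q) \<and> listed (x # rs)) \<or>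
    (\<exists>p' q'. 0 < p' \<and> 0 < q' \<and> p' \<le> p \<and> q' \<le> q \<and> (p' \<noteq> p \<or> q' \<noteq> q) \<and>
       listed (p' # q' # rs))" (is "_ \<longleftrightarrow> ?A \<or> ?B \<or> ?C")
proof -
  have rs: "filter (\<lambda>x. 0 < x) rs = rs"
    using assms(3) by simp
  show ?thesis
  proof
    assume "window_win (p # q # rs)"
    then obtain p' q' where *: "p' \<le> p" "q' \<le> q" "p' \<noteq> p \<or> q' \<noteq> q"
      "listed (filter (\<lambda>x. 0 < x) (p' # q' # rs))"
      unfolding window_win_Cons_Cons by blast
    consider "p' = 0" "q' = 0" | "p' = 0" "0 < q'" | "0 < p'" "q' = 0" | "0 < p'" "0 < q'"
      by blast
    then show "?A \<or> ?B \<or> ?C"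
    proof cases
      case 1 with *(4) rs show ?thesis by simp
    next
      case 2 with *(2,4) rs show ?thesis by auto
    next
      case 3 with *(1,4) rs show ?thesis by auto
    next
      case 4
      then have "listed (p' # q' # rs)"
        using *(4) rs by simp
      with 4 *(1-3) show ?thesis by blast
    qed
  next
    assume "?A \<or> ?B \<or> ?C"
    then consider "listed rs" | x where "0 < x" "x \<le> p" "listed (x # rs)"
      | x where "0 < x" "x \<le> q" "listed (x # rs)" | ?C
      by blast
    then show "window_win (p # q # rs)"
    proof cases
      case 1
      then show ?thesis
        using assms rs by (intro window_winI[of 0 0]) simp_all
    next
      case (2 x)
      then show ?thesis
        using assms rs by (intro window_winI[of x 0]) simp_all
    next
      case (3 x)
      then show ?thesis
        using assms rs by (intro window_winI[of 0 x]) simp_all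
    next
      case 4
      then obtain p' q' where "0 < p'" "0 < q'" "p' \<le> p" "q' \<le> q" "p' \<noteq> p \<or> q' \<noteq> q"
        "listed (p' # q' # rs)"
        by blast
      then show ?thesis
        using rs by (intro window_winI[of p' q']) simp_all
    qed
  qed
qed

section \<open>Winning moves with at most four piles\<close>

lemma winnable_0: "\<not> winnable []"
  by (simp add: winnable_conv)

lemma winnable_1:
  assumes "0 < a" shows "winnable [a]"
  using assms listed_Nil unfolding winnable_conv window_win_def
  by (auto intro!: exI[of _ "[0::nat]"])

lemma winnable_2:
  assumes "0 < a" "0 < b" shows "winnable [a, b]"
  using assms by (auto simp: winnable_conv Ex_less_Suc window_win_pos listed_Nil)

text \<open>The only reachable listed tuple is \<open>(r, r, r)\<close>: two piles are lowered to
  the third, so a minimal pile is left untouched.\<close>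

lemma winnable_3:
  assumes "0 < a" "0 < b" "0 < c" shows "winnable [a, b, c] \<longleftrightarrow> \<not> (a = b \<and> b = c)"
proof -
  have w: "window_win [p, q, r] \<longleftrightarrow> r \<le> p \<and> r \<le> q \<and> (r \<noteq> p \<or> r \<noteq> q)"
    if "0 < p" "0 < q" "0 < r" for p q r
    using that by (auto simp: window_win_pos not_listed listed_3 cong: conj_cong)
  have "winnable [a, b, c] \<longleftrightarrow> window_win [a, b, c] \<or> window_win [b, c, a] \<or> window_win [c, a, b]"
    by (auto simp: winnable_conv Ex_less_Suc)
  also have "\<dots> \<longleftrightarrow> \<not> (a = b \<and> b = c)"
    unfolding w[OF assms] w[OF assms(2,3,1)] w[OF assms(3,1,2)] by linarith
  finally show ?thesis .
qed

lemma winnable_4: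
  assumes "0 < a" "0 < b" "0 < c" "0 < d"
  shows "winnable [a, b, c, d] \<longleftrightarrow> \<not> (a = c \<and> b = d \<and> a \<noteq> b)"
proof -
  \<comment> \<open>Either one pile is emptied and three equal piles remain, or both survive as
    copies of their opposite piles.\<close>
  have w: "window_win [p, q, r, s] \<longleftrightarrow> r = s \<and> (r \<le> p \<or> r \<le> q) \<or>
     r \<le> p \<and> s \<le> q \<and> (r \<noteq> p \<or> s \<noteq> q) \<and> r \<noteq> s"
    if "0 < p" "0 < q" "0 < r" "0 < s" for p q r s
    using that by (auto simp: window_win_pos not_listed listed_3 listed_4 cong: conj_cong)
  have "winnable [a, b, c, d] \<longleftrightarrow> window_win [a, b, c, d] \<or> window_win [b, c, d, a] \<or>
      window_win [c, d, a, b] \<or> window_win [d, a, b, c]"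
    by (auto simp: winnable_conv Ex_less_Suc)
  \<comment> \<open>One pile from each opposite pair always gives two adjacent piles; hence the
    larger pile of each pair can be lowered in one window.\<close>
  also have "\<dots> \<longleftrightarrow> \<not> (a = c \<and> b = d \<and> a \<noteq> b)"
    unfolding w[OF assms] w[OF assms(2,3,4,1)] w[OF assms(3,4,1,2)] w[OF assms(4,1,2,3)]
    by (cases a c rule: linorder_cases; cases b d rule: linorder_cases) auto
  finally show ?thesis .
qed

section \<open>Windows and symmetries of five-pile configurations\<close>

lemma winnable_5:
  "winnable [a, b, c, d, e] \<longleftrightarrow> window_win [a, b, c, d, e] \<or> window_win [b, c, d, e, a] \<or>
      window_win [c, d, e, a, b] \<or> window_win [d, e, a, b, c] \<or> window_win [e, a, b, c, d]"
  by (auto simp: winnable_conv Ex_less_Suc)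

text \<open>Emptying both piles requires \<open>c = d = e\<close>. Emptying one requires
  \<open>c = e\<close> and a survivor of size \<open>d\<close>, with \<open>c\<close> and
  \<open>d\<close> distinct; that last restriction disappears because \<open>c = d\<close> already
  wins by emptying both.\<close>

lemma window_win_5:
  assumes "0 < p" "0 < q" "0 < c" "0 < d" "0 < e"
  shows "window_win [p, q, c, d, e] \<longleftrightarrow> c = e \<and> (c = d \<or> d \<le> p \<or> d \<le> q) \<or>
    (\<exists>p' q'. 0 < p' \<and> 0 < q' \<and> p' \<le> p \<and> q' \<le> q \<and> (p' \<noteq> p \<or> q' \<noteq> q) \<and>
       listed [p', q', c, d, e])"
  using assms by (simp add: window_win_pos listed_3 listed_4 cong: conj_cong) blast

lemma listed_5_rev: "listed [a, b, c, d, e] \<longleftrightarrow> listed [e, d, c, b, a]"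
  by (rule listed_cong) (use same_configuration_rev[of "[a, b, c, d, e]"] in simp)

lemma listed_5_rotate: "listed [a, b, c, d, e] \<longleftrightarrow> listed [b, c, d, e, a]"
  by (rule listed_cong) (use same_configuration_rotate[of "[a, b, c, d, e]" 1] in simp)

lemma window_win_5_swap:
  assumes "0 < p" "0 < q" "0 < c" "0 < d" "0 < e"
  shows "window_win [p, q, c, d, e] \<longleftrightarrow> window_win [q, p, e, d, c]"
proof -
  have "listed [p', q', c, d, e] \<longleftrightarrow> listed [q', p', e, d, c]" for p' q'
    by (metis listed_5_rev listed_5_rotate)
  then show ?thesis
    unfolding window_win_5[OF assms] window_win_5[OF assms(2,1,5,4,3)] by blast
qed

lemma winnable_5_rotate: "winnable [a, b, c, d, e] \<longleftrightarrow> winnable [b, c, d, e, a]"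
  unfolding winnable_5 by blast

lemma winnable_5_rev:
  assumes "0 < a" "0 < b" "0 < c" "0 < d" "0 < e"
  shows "winnable [a, b, c, d, e] \<longleftrightarrow> winnable [e, d, c, b, a]"
  unfolding winnable_5 window_win_5_swap[OF assms] window_win_5_swap[OF assms(2,3,4,5,1)]
    window_win_5_swap[OF assms(3,4,5,1,2)] window_win_5_swap[OF assms(4,5,1,2,3)]
    window_win_5_swap[OF assms(5,1,2,3,4)]
  by blast

text \<open>The sixth assumption excludes exactly the wins that empty a pile, and
  \<open>stuck\<close> those that keep all five.\<close>

lemma not_window_win_5I:
  assumes "0 < p" "0 < q" "0 < c" "0 < d" "0 < e"
    and "c \<noteq> e \<or> c \<noteq> d \<and> p < d \<and> q < d"
    and stuck: "\<And>x y. 0 < x \<Longrightarrow> x \<le> p \<Longrightarrow> 0 < y \<Longrightarrow> y \<le> q \<Longrightarrow> x \<noteq> p \<or> y \<noteq> q \<Longrightarrow>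
      five_piles_rotated x y c d e \<Longrightarrow> False"
  shows "\<not> window_win [p, q, c, d, e]"
proof
  assume "window_win [p, q, c, d, e]"
  then obtain x y where "0 < x" "0 < y" "x \<le> p" "y \<le> q" "x \<noteq> p \<or> y \<noteq> q" "listed [x, y, c, d, e]"
    using assms(6) unfolding window_win_5[OF assms(1-5)] by auto
  with stuck show False
    unfolding listed_5[OF \<open>0 < x\<close> \<open>0 < y\<close> assms(3-5)] by blast
qed

section \<open>No move between listed configurations\<close>

text \<open>These are the windows up to the reflection fixing \<open>M\<close>. Emptying a pile
  fails in the first two because the end piles of the untouched triple differ, and in the third
  because its middle pile \<open>M\<close> exceeds both piles of the window. Moves keeping five
  piles are refuted by arithmetic over the possible targets, including parity.\<close>

lemma far_no_window_win:
  assumes "far M m a b m" "0 < m"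
  shows "\<not> window_win [M, m, a, b, m]" (is ?A) "\<not> window_win [m, a, b, m, M]" (is ?B)
    "\<not> window_win [a, b, m, M, m]" (is ?C)
proof -
  have pos: "0 < M" "0 < m" "0 < a" "0 < b" "0 < m"
    using assms unfolding far_def by auto
  have False if "0 < x" "x \<le> M" "0 < y" "y \<le> m" "x \<noteq> M \<or> y \<noteq> m" "five_piles_rotated x y a b m" for x y
    using assms(1) that unfolding five_piles_def far_def near_def
    \<comment> \<open>Without the step \<open>-\<close> the chained disjunctions would return in every case.\<close>
    by - (elim disjE conjE; (linarith | presburger))
  moreover have "a \<noteq> m"
    using assms(1) unfolding far_def by auto
  ultimately show ?A
    by (intro not_window_win_5I[OF pos]) blast+
  have False if "0 < x" "x \<le> m" "0 < y" "y \<le> a" "x \<noteq> m \<or> y \<noteq> a" "five_piles_rotated x y b m M" for x y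
    using assms(1) that unfolding five_piles_def far_def near_def
    by - (elim disjE conjE; (linarith | presburger))
  moreover have "b \<noteq> M"
    using assms(1) unfolding far_def by auto
  ultimately show ?B
    by (intro not_window_win_5I[OF pos(2-5,1)]) blast+
  have False if "0 < x" "x \<le> a" "0 < y" "y \<le> b" "x \<noteq> a \<or> y \<noteq> b" "five_piles_rotated x y m M m" for x y
    using assms(1) that unfolding five_piles_def far_def near_def
    by - (elim disjE conjE; (linarith | presburger))
  moreover have "m \<noteq> M \<and> a < M \<and> b < M"
    using assms(1) unfolding far_def by auto
  ultimately show ?C
    by (intro not_window_win_5I[OF pos(3-5,1,2)]) blast+
qed

text \<open>The windows are again taken up to reflection. In the window \<open>(m, m)\<close> the
  ends \<open>N\<close> and \<open>M\<close> may agree, but then the middle pile \<open>p\<close>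
  differs from them and exceeds \<open>m\<close>.\<close>

lemma near_no_window_win:
  assumes "near p M m m N" "0 < m"
  shows "\<not> window_win [p, M, m, m, N]" (is ?A) "\<not> window_win [M, m, m, N, p]" (is ?B)
    "\<not> window_win [m, m, N, p, M]" (is ?C)
proof -
  have pos: "0 < p" "0 < M" "0 < m" "0 < m" "0 < N"
    using assms unfolding near_def by - (elim disjE conjE; linarith)+
  have False if "0 < x" "x \<le> p" "0 < y" "y \<le> M" "x \<noteq> p \<or> y \<noteq> M" "five_piles_rotated x y m m N" for x y
    using assms(1) that unfolding five_piles_def far_def near_def
    by - (elim disjE conjE; (linarith | presburger))
  moreover have "m \<noteq> N"
    using assms(1) unfolding near_def by - (elim disjE conjE; linarith)
  ultimately show ?A
    by (intro not_window_win_5I[OF pos]) blast+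
  have False if "0 < x" "x \<le> M" "0 < y" "y \<le> m" "x \<noteq> M \<or> y \<noteq> m" "five_piles_rotated x y m N p" for x y
    using assms(1) that unfolding five_piles_def far_def near_def
    by - (elim disjE conjE; (linarith | presburger))
  moreover have "m \<noteq> p"
    using assms(1) unfolding near_def by - (elim disjE conjE; linarith)
  ultimately show ?B
    by (intro not_window_win_5I[OF pos(2-5,1)]) blast+
  have False if "0 < x" "x \<le> m" "0 < y" "y \<le> m" "x \<noteq> m \<or> y \<noteq> m" "five_piles_rotated x y N p M" for x y
    using assms(1) that unfolding five_piles_def far_def near_def
    by - (elim disjE conjE; (linarith | presburger))
  moreover have "N \<noteq> M \<or> N \<noteq> p \<and> m < p"
    using assms(1) unfolding near_def by - (elim disjE conjE; linarith)
  ultimately show ?C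
    by (intro not_window_win_5I[OF pos(3-5,1,2)]) blast+
qed

lemma five_piles_no_window_win:
  assumes "five_piles a b c d e" "0 < b" "0 < c"
  shows "\<not> window_win [a, b, c, d, e] \<and> \<not> window_win [b, c, d, e, a] \<and>
    \<not> window_win [c, d, e, a, b]"
  using assms(1) unfolding five_piles_def
proof
  assume far: "far a b c d e"
  then have [simp]: "e = b"
    unfolding far_def by simp
  show ?thesis
    using far_no_window_win[of a b c d] far assms by simp
next
  assume near: "near a b c d e"
  then have [simp]: "d = c"
    unfolding near_def by simp
  show ?thesis
    using near_no_window_win[of a b c e] near assms by simp
qed

lemma five_piles_not_winnable:
  assumes "five_piles a b c d e" "0 < a" "0 < b" "0 < c" "0 < d" "0 < e"
  shows "\<not> winnable [a, b, c, d, e]"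
proof -
  \<comment> \<open>The two windows not treated so far are mirror images of windows of this
    reflected tuple.\<close>
  have "five_piles a e d c b"
    using assms(1) unfolding five_piles_def far_def near_def by - (elim disjE conjE; simp)
  then show ?thesis
    unfolding winnable_5
    using five_piles_no_window_win[of a b c d e] five_piles_no_window_win[of a e d c b] assms
      window_win_5_swap[of d e a b c] window_win_5_swap[of e a b c d]
    by simp
qed

lemma listed_5_not_winnable:
  assumes "0 < a" "0 < b" "0 < c" "0 < d" "0 < e" "listed [a, b, c, d, e]"
  shows "\<not> winnable [a, b, c, d, e]"
proof -
  note no_win = five_piles_not_winnable[OF _ assms(1-5)] five_piles_not_winnable[OF _ assms(2-5,1)]
    five_piles_not_winnable[OF _ assms(3-5,1,2)] five_piles_not_winnable[OF _ assms(4,5,1-3)]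
    five_piles_not_winnable[OF _ assms(5,1-4)]
  show ?thesis
    using assms(6) no_win unfolding listed_5[OF assms(1-5)] winnable_5 by blast
qed

section \<open>Winning moves\<close>

lemma winnable_5I:
  assumes "listed [x, y, c, d, e]" "0 < x" "0 < y" "x \<le> p" "y \<le> q" "x \<noteq> p \<or> y \<noteq> q"
    "0 < c" "0 < d" "0 < e"
  shows "winnable [p, q, c, d, e]"
proof -
  have "0 < p" "0 < q"
    using assms by linarith+
  then show ?thesis
    unfolding winnable_5 window_win_5[OF \<open>0 < p\<close> \<open>0 < q\<close> assms(7-9)] using assms by blast
qed

text \<open>Both piles of the window are emptied if \<open>d = c\<close>; otherwise one is emptied
  and the other lowered to \<open>d\<close>.\<close>

lemma winnable_gapI:
  assumes "d \<le> p \<or> d \<le> q \<or> d = c" "0 < p" "0 < q" "0 < c" "0 < d"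
  shows "winnable [p, q, c, d, c]"
  unfolding winnable_5 window_win_5[OF assms(2-5,4)] using assms(1) by blast

text \<open>The upper bounds in \<open>far\<close> are automatic: \<open>p - a = b - m\<close> and
  \<open>p - b = a - m\<close> are positive.\<close>

lemma five_piles_farI:
  assumes "m < a" "m < b" "m + p = a + b"
  shows "five_piles p m a b m"
  using assms unfolding five_piles_def far_def by auto

lemma five_piles_listed:
  assumes "five_piles a b c d e" "0 < a" "0 < b" "0 < c" "0 < d" "0 < e"
  shows "listed [a, b, c, d, e]" "listed [b, c, d, e, a]" "listed [c, d, e, a, b]"
    "listed [d, e, a, b, c]" "listed [e, a, b, c, d]"
  using assms by (simp_all add: listed_5)

text \<open>If \<open>p\<close> is at most \<open>a\<close> or \<open>b\<close>, or one of these
  equals \<open>m\<close>, a gap between two equal piles wins. Otherwise the balance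
  \<open>m + p = a + b\<close> is restored by lowering \<open>p\<close> to \<open>a + b - m\<close>
  or \<open>b\<close> to \<open>m + p - a\<close>; the latter exceeds \<open>m\<close> because
  \<open>a < p\<close>.\<close>

lemma winnable_far_minima:
  assumes "0 < m" "m \<le> p" "m \<le> a" "m \<le> b" "\<not> listed [p, m, a, b, m]"
  shows "winnable [p, m, a, b, m]"
proof -
  have pos: "0 < p" "0 < a" "0 < b"
    using assms by simp_all
  consider "p \<le> a \<or> p \<le> b" | "a < p" "b < p" "a = m" | "a < p" "b < p" "b = m"
    | "a < p" "b < p" "m < a" "m < b"
    using assms by linarith
  then show ?thesis
  proof cases
    case 1
    then have "winnable [a, b, m, p, m]"
      using assms(1) pos by (intro winnable_gapI) auto
    then show ?thesis
      by (metis winnable_5_rotate)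
  next
    case 2
    then show ?thesis
      using assms(1) pos winnable_gapI[of b p m m] by simp
  next
    case 3
    then have "winnable [m, p, m, a, m]"
      using assms(1) pos by (intro winnable_gapI) auto
    with 3 show ?thesis
      by (metis winnable_5_rotate)
  next
    case 4
    consider "m + p = a + b" | "a + b < m + p" | "m + p < a + b"
      by linarith
    then show ?thesis
    proof cases
      case 1
      then have "five_piles p m a b m"
        using 4 by (intro five_piles_farI) auto
      then show ?thesis
        using five_piles_listed assms pos by blast
    next
      case 2
      then have "five_piles (a + b - m) m a b m"
        using 4 by (intro five_piles_farI) auto
      then have "listed [a + b - m, m, a, b, m]"
        using assms(1) pos 4 by (intro five_piles_listed) auto
      then show ?thesis
        using assms(1) pos 2 4 by (intro winnable_5I[of "a + b - m" m]) auto
    next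
      case 3
      then have "five_piles p m a (m + p - a) m"
        using 4 by (intro five_piles_farI) auto
      then have "listed [a, m + p - a, m, p, m]"
        using assms(1) pos 4 by (intro five_piles_listed) auto
      then have "winnable [a, b, m, p, m]"
        using assms(1) pos 3 4 by (intro winnable_5I[of a "m + p - a"]) auto
      then show ?thesis
        by (metis winnable_5_rotate)
    qed
  qed
qed

text \<open>If \<open>a = d\<close>, the minimum is a gap between equal piles. Otherwise
  \<open>b\<close> is lowered to \<open>m\<close>, which puts \<open>a\<close> between two minima,
  and the other pile of the window restores the balance: \<open>a\<close> drops to
  \<open>c + d - m\<close> or \<open>c\<close> to \<open>a + m - d\<close>.\<close>

lemma winnable_unique_min_le:
  assumes "0 < m" "m < a" "m < b" "m < c" "m < d" "d \<le> a"
  shows "winnable [m, a, b, c, d]"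
proof -
  consider "a = d" | "d < a" "c + d \<le> a + m" | "d < a" "a + m < c + d"
    using assms by linarith
  then show ?thesis
  proof cases
    case 1
    have "winnable [b, c, d, m, d]"
      using assms by (intro winnable_gapI) auto
    with 1 show ?thesis
      by (metis winnable_5_rotate)
  next
    case 2
    then have "five_piles (c + d - m) m c d m"
      using assms by (intro five_piles_farI) auto
    then have "listed [c + d - m, m, c, d, m]"
      using assms by (intro five_piles_listed) auto
    then have "winnable [a, b, c, d, m]"
      using assms 2 by (intro winnable_5I[of "c + d - m" m]) auto
    then show ?thesis
      by (metis winnable_5_rotate)
  next
    case 3
    then have "five_piles a m (a + m - d) d m"
      using assms by (intro five_piles_farI) auto
    then have "listed [m, a + m - d, d, m, a]"
      using assms 3 by (intro five_piles_listed) auto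
    then have "winnable [b, c, d, m, a]"
      using assms 3 by (intro winnable_5I[of m "a + m - d"]) auto
    then show ?thesis
      by (metis winnable_5_rotate)
  qed
qed

lemma winnable_unique_min:
  assumes "0 < m" "m < a" "m < b" "m < c" "m < d"
  shows "winnable [m, a, b, c, d]"
proof (cases "d \<le> a")
  case True
  with assms show ?thesis
    by (intro winnable_unique_min_le)
next
  case False
  with assms have "winnable [m, d, c, b, a]"
    by (intro winnable_unique_min_le) auto
  then have "winnable [d, c, b, a, m]"
    by (metis winnable_5_rotate)
  then show ?thesis
    using assms by (subst winnable_5_rev) auto
qed

section \<open>Minimum at exactly two adjacent places\<close>

lemma winnable_near_minima_move:
  assumes "0 < m" "five_piles x M m m y" "0 < x" "0 < M" "0 < y" "x \<le> p" "y \<le> N" "\<not> listed [p, M, m, m, N]"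
  shows "winnable [p, M, m, m, N]"
proof -
  have *: "listed [y, x, M, m, m]"
    using assms by (intro five_piles_listed) auto
  then have "listed [x, M, m, m, y]"
    by (metis listed_5_rotate)
  then have "x \<noteq> p \<or> y \<noteq> N"
    using assms(8) by blast
  then have "winnable [N, p, M, m, m]"
    using * assms by (intro winnable_5I) auto
  then show ?thesis
    by (metis winnable_5_rotate)
qed

text \<open>The piles \<open>p\<close> and \<open>N\<close> are adjacent, so one move can adjust
  both while \<open>M\<close> stays. Taking \<open>M\<close> as the smaller neighbour of the minima
  makes \<open>N\<close> large enough for every target used.\<close>

lemma winnable_near_minima_le:
  assumes "0 < m" "m < p" "m < M" "M \<le> N" "\<not> listed [p, M, m, m, N]"
  shows "winnable [p, M, m, m, N]"
proof -
  note move = winnable_near_minima_move[OF \<open>0 < m\<close> _ _ _ _ _ _ assms(5)]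
  consider "m + 2 \<le> M" "even m \<or> m + 3 \<le> M" | "even m" "M = m + 1" | "odd m" "M = m + 1" "N = m + 1" "p = m + 1"
    | "odd m" "M = m + 1" "N = m + 1" "m + 2 \<le> p" | "odd m" "M = m + 1" "m + 2 \<le> N"
    | "odd m" "M = m + 2"
  proof -
    have "M = m + 1 \<or> m + 2 \<le> M" "M = m + 1 \<or> M = m + 2 \<or> m + 3 \<le> M"
      "N = m + 1 \<or> m + 2 \<le> N" "p = m + 1 \<or> m + 2 \<le> p"
      using assms(2-4) by linarith+
    then show ?thesis
      using that by blast
  qed
  then show ?thesis
  proof cases
    case 1
    then have "five_piles (m + 1) M m m M"
      unfolding five_piles_def near_def by blast
    from move[OF this] show ?thesis
      using assms(1-4) 1 by simp
  next
    case 2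
    from \<open>even m\<close> \<open>0 < m\<close> obtain k where m: "m = Suc k" and "odd k"
      by (cases m) auto
    then have "0 < k"
      using odd_pos by blast
    \<comment> \<open>With \<open>M = m + 1 = k + 2\<close>, lowering \<open>p\<close> and
      \<open>N\<close> to the odd number \<open>k = m - 1\<close> makes them the new adjacent
      minima; the old minima become \<open>k + 1\<close>.\<close>
    have "five_piles m m k k (m + 1)"
      using \<open>odd k\<close> m by (simp add: five_piles_def near_def)
    then have "listed [k, k, m + 1, m, m]"
      using \<open>0 < k\<close> m by (intro five_piles_listed) auto
    then have "winnable [N, p, M, m, m]"
      using assms 2 m \<open>0 < k\<close> by (intro winnable_5I[of k k]) auto
    then show ?thesis
      by (metis winnable_5_rotate)
  next
    case 3
    \<comment> \<open>All three piles outside the minima equal \<open>m + 1\<close>, so emptying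
      both minima wins.\<close>
    then have "winnable [m, m, N, p, N]"
      using assms by (intro winnable_gapI) auto
    with 3 show ?thesis
      by (metis winnable_5_rotate)
  next
    case 4
    then have "five_piles (m + 2) M m m (m + 1)"
      unfolding five_piles_def near_def by simp
    from move[OF this] show ?thesis
      using assms(1-4) 4 by simp
  next
    case 5
    then have "five_piles (m + 1) M m m (m + 2)"
      unfolding five_piles_def near_def by simp
    from move[OF this] show ?thesis
      using assms(1-4) 5 by simp
  next
    case 6
    then have "five_piles (m + 1) M m m (m + 1)"
      unfolding five_piles_def near_def by simp
    from move[OF this] show ?thesis
      using assms(1-4) 6 by simp
  qed
qed

lemma winnable_near_minima:
  assumes "0 < m" "m < p" "m < M" "m < N" "\<not> listed [p, M, m, m, N]"
  shows "winnable [p, M, m, m, N]"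
proof (cases "M \<le> N")
  case True
  with assms show ?thesis
    by (intro winnable_near_minima_le)
next
  case False
  have "\<not> listed [p, N, m, m, M]"
    using assms(5) by (metis listed_5_rev listed_5_rotate)
  with False assms have "winnable [p, N, m, m, M]"
    by (intro winnable_near_minima_le) auto
  then have "winnable [N, m, m, M, p]"
    by (metis winnable_5_rotate)
  then show ?thesis
    using assms by (subst winnable_5_rev) auto
qed

section \<open>Case distinction on the places of the minimum\<close>

lemma winnable_5_min_first:
  assumes "0 < a" "a \<le> b" "a \<le> c" "a \<le> d" "a \<le> e" "\<not> listed [a, b, c, d, e]"
  shows "winnable [a, b, c, d, e]"
proof -
  have rots: "\<not> listed [b, c, d, e, a]" "\<not> listed [c, d, e, a, b]" "\<not> listed [d, e, a, b, c]"
     "\<not> listed [e, a, b, c, d]"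
    using assms(6) by (metis listed_5_rotate)+
  \<comment> \<open>The first three cases have two non-adjacent minima, the next two exactly two
    adjacent ones, and the last a unique minimum.\<close>
  consider "c = a" | "d = a" | "b = a" "e = a" | "b = a" "a < c" "a < d" "a < e"
    | "e = a" "a < b" "a < c" "a < d" | "a < b" "a < c" "a < d" "a < e"
    using assms(2-5) by (auto simp: le_less)
  then show ?thesis
  proof cases
    case 1
    then have "winnable [b, c, d, e, a]"
      using assms rots winnable_far_minima[of a b d e] by simp
    then show ?thesis by (metis winnable_5_rotate)
  next
    case 2
    then have "winnable [e, a, b, c, d]"
      using assms rots winnable_far_minima[of a e b c] by simp
    then show ?thesis by (metis winnable_5_rotate)
  next
    case 3
    then show ?thesis
      using assms rots winnable_far_minima[of a a c d] by simp
  next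
    case 4
    then have "winnable [d, e, a, b, c]"
      using assms rots winnable_near_minima[of a d e c] by simp
    then show ?thesis by (metis winnable_5_rotate)
  next
    case 5
    then have "winnable [c, d, e, a, b]"
      using assms rots winnable_near_minima[of a c d b] by simp
    then show ?thesis by (metis winnable_5_rotate)
  next
    case 6
    then show ?thesis
      using assms by (intro winnable_unique_min)
  qed
qed

lemma winnable_5_if_not_listed:
  assumes "0 < a" "0 < b" "0 < c" "0 < d" "0 < e" "\<not> listed [a, b, c, d, e]"
  shows "winnable [a, b, c, d, e]"
proof -
  have rots: "\<not> listed [b, c, d, e, a]" "\<not> listed [c, d, e, a, b]" "\<not> listed [d, e, a, b, c]"
     "\<not> listed [e, a, b, c, d]"
    using assms(6) by (metis listed_5_rotate)+
  define m where "m = Min {a, b, c, d, e}"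
  have "m \<in> {a, b, c, d, e}" "m \<le> a" "m \<le> b" "m \<le> c" "m \<le> d" "m \<le> e"
    unfolding m_def by (intro Min_in Min_le; simp)+
  then have "winnable [a, b, c, d, e] \<or> winnable [b, c, d, e, a] \<or> winnable [c, d, e, a, b] \<or>
      winnable [d, e, a, b, c] \<or> winnable [e, a, b, c, d]"
    using assms rots winnable_5_min_first[of a b c d e] winnable_5_min_first[of b c d e a]
      winnable_5_min_first[of c d e a b] winnable_5_min_first[of d e a b c]
      winnable_5_min_first[of e a b c d]
    by blast
  then show ?thesis
    by (metis winnable_5_rotate)
qed

lemma winnable_iff_not_listed:
  assumes "scn_configuration 5 xs"
  shows "winnable xs \<longleftrightarrow> \<not> listed xs"
proof -
  have pos: "\<forall>x\<in>set xs. 0 < x" and "length xs \<le> 5"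
    using assms unfolding scn_configuration_def by auto
  then consider "xs = []" | a where "xs = [a]" | a b where "xs = [a, b]" | a b c where "xs = [a, b, c]"
    | a b c d where "xs = [a, b, c, d]" | a b c d e where "xs = [a, b, c, d, e]"
  proof -
    have "length xs = 0 \<or> length xs = 1 \<or> length xs = 2 \<or> length xs = 3 \<or> length xs = 4 \<or> length xs = 5"
      using \<open>length xs \<le> 5\<close> by linarith
    then show ?thesis
      using that by (auto simp: length_Suc_conv eval_nat_numeral)
  qed
  then show ?thesis
  proof cases
    case 1
    then show ?thesis by (simp add: winnable_0 listed_Nil)
  next
    case 2
    then show ?thesis using pos by (simp add: winnable_1 not_listed)
  next
    case 3
    then show ?thesis using pos by (simp add: winnable_2 not_listed)
  next
    case 4
    then show ?thesis using pos by (simp add: winnable_3 listed_3)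
  next
    case 5
    then show ?thesis using pos by (simp add: winnable_4 listed_4)
  next
    case (6 a b c d e)
    then show ?thesis
      using pos winnable_5_if_not_listed listed_5_not_winnable by auto
  qed
qed

section \<open>Outcomes\<close>

lemma previous_wins_iff: "previous_wins move x \<longleftrightarrow> (\<forall>y. move x y \<longrightarrow> next_wins move y)"
  by (auto intro: previous_wins_next_wins.intros elim: previous_wins.cases)

lemma next_wins_iff: "next_wins move x \<longleftrightarrow> (\<exists>y. move x y \<and> previous_wins move y)"
  by (auto intro: previous_wins_next_wins.intros elim: next_wins.cases)

section \<open>The number of stones as a termination measure\<close>

lemma sum_list_filter_pos: "sum_list (filter (\<lambda>x. 0 < x) zs) = sum_list (zs :: nat list)"
  by (induction zs) auto

lemma sum_list_less:
  fixes xs zs :: "nat list"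
  assumes "length zs = length xs" "zs \<noteq> xs" "\<forall>j<length xs. zs ! j \<le> xs ! j"
  shows "sum_list zs < sum_list xs"
proof -
  obtain j where "j < length xs" "zs ! j \<noteq> xs ! j"
    using assms(1,2) nth_equalityI by metis
  with assms(3) have "(\<Sum>j<length xs. zs ! j) < (\<Sum>j<length xs. xs ! j)"
    by (intro sum_strict_mono_ex1) (auto intro!: bexI[of _ j] simp: le_neq_implies_less)
  then show ?thesis
    using assms(1) by (simp add: sum_list_sum_nth atLeast0LessThan)
qed

lemma scn_move_decreases:
  assumes "scn_move k xs ys"
  shows "sum_list ys < sum_list xs"
  using assms sum_list_less unfolding scn_move_def by (auto simp: sum_list_filter_pos)

lemma scn_move_configuration:
  assumes "scn_move k xs ys" "scn_configuration n xs"
  shows "scn_configuration n ys"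
  using assms unfolding scn_move_def scn_configuration_def
  by (auto intro: order_trans[OF length_filter_le])

text \<open>Induction on the number of stones. Both outcomes are treated together, since each is
  characterised through the other after one move.\<close>

lemma outcome_iff_listed:
  assumes "scn_configuration 5 xs"
  shows "(previous_wins (scn_move 2) xs \<longleftrightarrow> listed xs) \<and> (next_wins (scn_move 2) xs \<longleftrightarrow> \<not> listed xs)"
  using assms
proof (induction "sum_list xs" arbitrary: xs rule: less_induct)
  case less
  have IH: "(previous_wins (scn_move 2) ys \<longleftrightarrow> listed ys) \<and> (next_wins (scn_move 2) ys \<longleftrightarrow> \<not> listed ys)"
    if "scn_move 2 xs ys" for ys
    using less that scn_move_decreases scn_move_configuration by blast
  have "previous_wins (scn_move 2) xs \<longleftrightarrow> \<not> winnable xs"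
    "next_wins (scn_move 2) xs \<longleftrightarrow> winnable xs"
    unfolding previous_wins_iff[of _ xs] next_wins_iff[of _ xs] winnable_def using IH by blast+
  then show ?case
    using winnable_iff_not_listed[OF less.prems] by simp
qed

text \<open>This supplies the configuration half of \<open>scn_P_position\<close> for the direction
  from listed tuples to P-positions.\<close>

lemma listed_configuration:
  assumes "listed xs"
  shows "scn_configuration 5 xs"
proof -
  obtain ys where ys: "same_configuration xs ys" "normal_form ys"
    using assms unfolding listed_def by blast
  have "length ys \<le> 5 \<and> (\<forall>y\<in>set ys. 0 < y)"
    using ys(2) unfolding normal_form_def by (elim disjE exE conjE) auto
  moreover have "length ys = length xs" "set ys = set xs"
    using ys(1) unfolding same_configuration_def by auto
  ultimately show ?thesis
    unfolding scn_configuration_def by simp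
qed

theorem theorem3p2:
  fixes xs :: "nat list"
  shows "scn_P_position 5 2 xs \<longleftrightarrow>
    (\<exists>ys. same_configuration xs ys \<and>
      (ys = [] \<or>
       (\<exists>a. a \<ge> 1 \<and> ys = [a, a, a]) \<or>
       (\<exists>a b. a \<ge> 1 \<and> b \<ge> 1 \<and> a \<noteq> b \<and> ys = [a, b, a, b]) \<or>
       (\<exists>m M a b. m \<ge> 1 \<and> m < a \<and> a < M \<and> m < b \<and> b < M \<and> m + M = a + b \<and>
          ys = [M, m, a, b, m]) \<or>
       (\<exists>m M. m \<ge> 1 \<and> even m \<and> M \<ge> m + 2 \<and> ys = [m + 1, M, m, m, M]) \<or>
       (\<exists>m M. m \<ge> 1 \<and> odd m \<and> M \<ge> m + 3 \<and> ys = [m + 1, M, m, m, M]) \<or>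
       (\<exists>m. m \<ge> 1 \<and> odd m \<and> ys = [m + 2, m + 1, m, m, m + 1]) \<or>
       (\<exists>m. m \<ge> 1 \<and> odd m \<and> ys = [m + 1, m + 1, m, m, m + 2])))"
proof -
  have "scn_P_position 5 2 xs \<longleftrightarrow> listed xs"
    unfolding scn_P_position_def using outcome_iff_listed listed_configuration by blast
  then show ?thesis
    unfolding listed_def normal_form_def .
qed

end
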